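(* One has $f_3(N)=\frac58 N+O(1)$; that is, there is an absolute constant $K>0$ such that $\left|f_3(N)-\frac58 N\right|\leq K$ for every positive integer $N$.
   Context: For a positive integer $N$, $f_3(N)$ denotes the least integer such that every set $A\subseteq\{1,\ldots,N\}$ of size $|A|\geq f_3(N)$ contains (pairwise) distinct $a,b,c\in A$ with $a+b,\ a+c,\ b+c\in A$ (ordinary integer addition). *)

theory Defs
  imports Complex_Main
begin

definition has_triple_with_sums :: "nat set \<Rightarrow> bool" where
  "has_triple_with_sums A \<longleftrightarrow>
     (\<exists>a\<in>A. \<exists>b\<in>A. \<exists>c\<in>A. a \<noteq> b \<and> a \<noteq> c \<and> b \<noteq> c \<and>
        a + b \<in> A \<and> a + c \<in> A \<and> b + c \<in> A)"

(* The minimum exists, since m = N + 1 satisfies the condition vacuously; m = 0 fails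
   because of the empty set, so taking the least natural number is the same as taking
   the least integer. *)
definition f3 :: "nat \<Rightarrow> nat" where
  "f3 N = (LEAST m. \<forall>A. A \<subseteq> {1..N} \<and> m \<le> card A \<longrightarrow> has_triple_with_sums A)"

end

theory Submission
  imports Defs
begin

text \<open>
Call \<open>A\<close> triple-free if it has no distinct \<open>a, b, c\<close> as in the definition. For the lower bound, the
numbers in \<open>(N/2, N]\<close> together with those in \<open>[N/8, N/4]\<close> are triple-free: two of
\<open>a, b, c\<close> lie in the same part, and then their sum lies in neither.

For the upper bound fix \<open>a \<in> A\<close> and let \<open>D\<close> be the set of \<open>y < a\<close> with \<open>y, y + a \<in> A\<close>. If \<open>x, y\<close>
are distinct elements of \<open>D\<close>, then \<open>a + x\<close> and \<open>a + y\<close> lie in \<open>A\<close>, so \<open>x + y\<close> does not. In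
particular, modulo \<open>a\<close>, a sum of two distinct elements of \<open>D\<close> is neither \<open>0\<close> nor in \<open>D\<close>. It follows that
for all \<open>u, v \<in> D\<close> the four sets \<open>D\<close>, \<open>-D\<close>, \<open>u - D\<close>, \<open>D - v\<close> of residues are almost pairwise disjoint,
with one exception: \<open>u - D\<close> meets \<open>D - v\<close> once for every representation \<open>x + y = u + v\<close>.
Hence every \<open>u + v\<close> has at least \<open>4|D| - a - O(1)\<close> representations modulo \<open>a\<close> (lemma
\<open>popular_sums\<close>). But if \<open>u\<close> is the maximum of \<open>D\<close> and \<open>v\<close> is one of its largest elements, then the
integer \<open>u + v\<close> has few representations, so \<open>u + v - a\<close> is a sum of two distinct elements as
well, and both \<open>u + v - a\<close> and \<open>(u + v - a) + a\<close> are missing from \<open>A\<close>. Letting \<open>v\<close> vary gives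
\<open>4|D| \<le> a + e + O(1)\<close>, where \<open>e\<close> is the number of pairs \<open>(t, t + a)\<close> that \<open>A\<close> misses completely
(lemma \<open>both_le_neither\<close>).

If \<open>A\<close> contains an \<open>a\<close> close to \<open>N/2\<close>, the numbers up to \<open>N\<close> fall into the pairs \<open>(y, y + a)\<close>, so that
\<open>|A| \<le> N/2 + |D| - e + O(1) \<le> N/2 + a/4 + O(1)\<close>, which is \<open>5N/8 + O(1)\<close>. In
general let \<open>a\<close> be the least element of \<open>A\<close> that is at least \<open>N/2\<close>, and \<open>b\<close> the largest one below
\<open>N/2\<close>. The gap between them costs elements of \<open>A\<close>; depending on how it is
placed around \<open>N/2\<close>, the argument works with \<open>a\<close> or with \<open>b\<close>. In the second case small \<open>y\<close> have
\<open>b + y\<close> in the gap, so \<open>e\<close> is large by induction on \<open>N\<close> (lemma \<open>triple_free_card_le\<close>).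
\<close>

section \<open>Four almost disjoint sets of residues\<close>

lemma dvd_window:
  fixes a w :: int
  assumes "a dvd w" "- a < w" "w < 2 * a"
  shows "w = 0 \<or> w = a"
proof -
  obtain k where k: "w = a * k" using assms(1) by (elim dvdE)
  have "a > 0" using assms by linarith
  moreover have "a * (-1) < a * k" "a * k < a * 2" using assms k by (auto simp: mult.commute)
  ultimately have "-1 < k" "k < 2" by (simp_all only: mult_less_cancel_left_pos)
  then have "k = 0 \<or> k = 1" by auto
  then show ?thesis using k by auto
qed

lemma card_double_residue:
  fixes a c :: int
  assumes D: "D \<subseteq> {0<..<a}" and c: "0 \<le> c" "c < a"
  shows "card {x \<in> D. a dvd 2 * x - c} \<le> 2"
proof -
  have "{x \<in> D. a dvd 2 * x - c} \<subseteq> {c div 2, (c + a) div 2}"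
  proof
    fix x assume "x \<in> {x \<in> D. a dvd 2 * x - c}"
    then have x: "0 < x" "x < a" "a dvd 2 * x - c" using D by auto
    then have "2 * x - c = 0 \<or> 2 * x - c = a" using c by (intro dvd_window) auto
    then show "x \<in> {c div 2, (c + a) div 2}" by auto
  qed
  then have "card {x \<in> D. a dvd 2 * x - c} \<le> card {c div 2, (c + a) div 2}"
    by (intro card_mono) auto
  also have "\<dots> \<le> 2" by (simp add: card_insert_if)
  finally show ?thesis .
qed

lemma mod_affine_inj_on:
  fixes a c s :: int
  assumes D: "D \<subseteq> {0<..<a}" and s: "s = 1 \<or> s = -1"
  shows "inj_on (\<lambda>x. (c + s * x) mod a) D"
proof (rule inj_onI)
  fix x y assume xy: "x \<in> D" "y \<in> D" "(c + s * x) mod a = (c + s * y) mod a"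
  have "a dvd (c + s * x) - (c + s * y)" using xy(3) by (simp add: mod_eq_dvd_iff)
  then have "a dvd x - y" using s by (auto simp: dvd_diff_commute)
  moreover have "0 < x" "x < a" "0 < y" "y < a" using xy D by auto
  ultimately show "x = y" using dvd_window[of a "x - y"] by auto
qed

text \<open>
The images of \<open>D\<close> under \<open>x\<close>, \<open>-x\<close>, \<open>u - x\<close>, \<open>x - v\<close> have \<open>4|D|\<close> elements in total and lie in a set of
\<open>a\<close> residues. A common element of two of the images, other than the third and the fourth, is a
relation excluded by the hypotheses unless it is degenerate: either \<open>x = u\<close> or \<open>x = v\<close>, or both
of its summands are equal and \<open>2x\<close> is one of \<open>0, u, v\<close> modulo \<open>a\<close>. These degenerate cases
add up to \<open>8\<close>.
\<close>
lemma popular_sums: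
  fixes D :: "int set" and a u v :: int
  assumes D: "D \<subseteq> {0<..<a}" and u: "u \<in> D" and v: "v \<in> D"
    and zero: "\<And>x y. x \<in> D \<Longrightarrow> y \<in> D \<Longrightarrow> x \<noteq> y \<Longrightarrow> \<not> a dvd x + y"
    and free: "\<And>x y z. x \<in> D \<Longrightarrow> y \<in> D \<Longrightarrow> z \<in> D \<Longrightarrow> x \<noteq> y \<Longrightarrow> \<not> a dvd x + y - z"
  shows "4 * card D \<le> nat a + card {x \<in> D. \<exists>y\<in>D. a dvd x + y - (u + v)} + 8"
proof -
  have fin: "finite D" using D finite_subset by blast
  have a: "a > 0" using u D by fastforce
  \<comment> \<open>The four sets are \<open>F 0 1\<close>, \<open>F 0 (-1)\<close>, \<open>F u (-1)\<close> and \<open>F (-v) 1\<close>.\<close>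
  define F where "F c s = (\<lambda>x. (c + s * x) mod a) ` D" for c s :: int
  have finF: "finite (F c s)" for c s using fin by (simp add: F_def)
  have cardF: "card (F c s) = card D" if "s = 1 \<or> s = -1" for c s
    unfolding F_def using mod_affine_inj_on[OF D that] by (rule card_image)
  have subF: "F c s \<subseteq> {0..<a}" for c s using a by (auto simp: F_def)
  let ?R = "\<lambda>c. {x \<in> D. a dvd 2 * x - c}"
  have R: "card (?R c) \<le> 2" if "0 \<le> c" "c < a" for c
    using card_double_residue[OF D that] .
  have eqD: "\<exists>y\<in>D. a dvd (c + s * x) - (c' + s' * y)" if "x \<in> D" "(c + s * x) mod a \<in> F c' s'"
    for c s c' s' x using that by (auto simp: F_def mod_eq_dvd_iff)
  have meet: "card (F c s \<inter> F c' s') \<le> card X"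
    if "X \<subseteq> D" "\<And>x y. x \<in> D \<Longrightarrow> y \<in> D \<Longrightarrow> a dvd (c + s * x) - (c' + s' * y) \<Longrightarrow> x \<in> X"
    for c s c' s' X
  proof -
    have "F c s \<inter> F c' s' \<subseteq> (\<lambda>x. (c + s * x) mod a) ` X"
    proof
      fix r assume r: "r \<in> F c s \<inter> F c' s'"
      then obtain x where x: "x \<in> D" "r = (c + s * x) mod a" by (auto simp: F_def)
      then have "x \<in> X" using eqD[of x c s c' s'] r that(2) by blast
      then show "r \<in> (\<lambda>x. (c + s * x) mod a) ` X" using x by blast
    qed
    moreover have "finite X" using that(1) fin finite_subset by blast
    ultimately show ?thesis using surj_card_le by blast
  qed
  have m12: "card (F 0 1 \<inter> F 0 (-1)) \<le> 2"
  proof -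
    have "card (F 0 1 \<inter> F 0 (-1)) \<le> card (?R 0)"
    proof (rule meet)
      fix x y assume xy: "x \<in> D" "y \<in> D" "a dvd 0 + 1 * x - (0 + - 1 * y)"
      then have "x = y" using zero[of x y] by auto
      then show "x \<in> ?R 0" using xy by auto
    qed auto
    then show ?thesis using R[of 0] a by simp
  qed
  have m13: "card (F 0 1 \<inter> F u (-1)) \<le> 2"
  proof -
    have "card (F 0 1 \<inter> F u (-1)) \<le> card (?R u)"
    proof (rule meet)
      fix x y assume xy: "x \<in> D" "y \<in> D" "a dvd 0 + 1 * x - (u + - 1 * y)"
      then have e: "a dvd x + y - u" by (simp add: algebra_simps)
      then have "x = y" using free[of x y u] xy u by auto
      then show "x \<in> ?R u" using xy e by auto
    qed auto
    then show ?thesis using R[of u] u D by fastforce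
  qed
  have m14: "card (F 0 1 \<inter> F (-v) 1) \<le> 1"
  proof -
    have "card (F 0 1 \<inter> F (-v) 1) \<le> card {v}"
    proof (rule meet)
      fix x y assume xy: "x \<in> D" "y \<in> D" "a dvd 0 + 1 * x - (- v + 1 * y)"
      then have "a dvd x + v - y" by (simp add: algebra_simps)
      then show "x \<in> {v}" using free[of x v y] xy v by auto
    qed (use v in auto)
    then show ?thesis by simp
  qed
  have m23: "card (F 0 (-1) \<inter> F u (-1)) \<le> 1"
  proof -
    have "card (F 0 (-1) \<inter> F u (-1)) \<le> card {u}"
    proof (rule meet)
      fix x y assume xy: "x \<in> D" "y \<in> D" "a dvd 0 + - 1 * x - (u + - 1 * y)"
      then have "a dvd - (x + u - y)" by (simp add: algebra_simps)
      then have "a dvd x + u - y" by (simp only: dvd_minus_iff)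
      then show "x \<in> {u}" using free[of x u y] xy u by auto
    qed (use u in auto)
    then show ?thesis by simp
  qed
  have m24: "card (F 0 (-1) \<inter> F (-v) 1) \<le> 2"
  proof -
    have "card (F 0 (-1) \<inter> F (-v) 1) \<le> card (?R v)"
    proof (rule meet)
      fix x y assume xy: "x \<in> D" "y \<in> D" "a dvd 0 + - 1 * x - (- v + 1 * y)"
      then have "a dvd - (x + y - v)" by (simp add: algebra_simps)
      then have e: "a dvd x + y - v" by (simp only: dvd_minus_iff)
      then have "x = y" using free[of x y v] xy v by auto
      then show "x \<in> ?R v" using xy e by auto
    qed auto
    then show ?thesis using R[of v] v D by fastforce
  qed
  let ?S = "{x \<in> D. \<exists>y\<in>D. a dvd x + y - (u + v)}"
  have m34: "card (F u (-1) \<inter> F (-v) 1) \<le> card ?S"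
  proof (rule meet)
    fix x y assume xy: "x \<in> D" "y \<in> D" "a dvd u + - 1 * x - (- v + 1 * y)"
    then have "a dvd - (x + y - (u + v))" by (simp add: algebra_simps)
    then have "a dvd x + y - (u + v)" by (simp only: dvd_minus_iff)
    then show "x \<in> ?S" using xy by auto
  qed auto
  define P Q where "P = F 0 1 \<union> F 0 (-1)" and "Q = F u (-1) \<union> F (-v) 1"
  have P: "2 * card D = card P + card (F 0 1 \<inter> F 0 (-1))"
    unfolding P_def using card_Un_Int[OF finF finF, of 0 1 0 "-1"] cardF by simp
  have Q: "2 * card D = card Q + card (F u (-1) \<inter> F (-v) 1)"
    unfolding Q_def using card_Un_Int[OF finF finF, of u "-1" "-v" 1] cardF by simp
  have PQ: "card P + card Q = card (P \<union> Q) + card (P \<inter> Q)"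
    by (rule card_Un_Int) (auto simp: P_def Q_def finF)
  have "P \<inter> Q = (F 0 1 \<inter> F u (-1) \<union> F 0 1 \<inter> F (-v) 1)
      \<union> (F 0 (-1) \<inter> F u (-1) \<union> F 0 (-1) \<inter> F (-v) 1)"
    by (auto simp: P_def Q_def)
  then have "card (P \<inter> Q) \<le> card (F 0 1 \<inter> F u (-1) \<union> F 0 1 \<inter> F (-v) 1)
      + card (F 0 (-1) \<inter> F u (-1) \<union> F 0 (-1) \<inter> F (-v) 1)"
    by (simp add: card_Un_le)
  also have "\<dots> \<le> 6"
    using card_Un_le[of "F 0 1 \<inter> F u (-1)" "F 0 1 \<inter> F (-v) 1"]
      card_Un_le[of "F 0 (-1) \<inter> F u (-1)" "F 0 (-1) \<inter> F (-v) 1"] m13 m14 m23 m24 by linarith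
  finally have i: "card (P \<inter> Q) \<le> 6" .
  have "card (P \<union> Q) \<le> card {0..<a}"
    using subF by (intro card_mono) (auto simp: P_def Q_def)
  then have "card (P \<union> Q) \<le> nat a" by simp
  then show ?thesis using P Q PQ i m12 m34 by linarith
qed

section \<open>Pairs at distance a\<close>

lemma card_top_elements:
  fixes D :: "'a::linorder set"
  assumes "finite D" "J \<le> card D"
  shows "J \<le> card {v \<in> D. card {x \<in> D. v \<le> x} \<le> J}"
proof (cases "{v \<in> D. J < card {x \<in> D. v \<le> x}} = {}")
  case True
  then have "{v \<in> D. card {x \<in> D. v \<le> x} \<le> J} = D" by force
  then show ?thesis using assms by simp
next
  case False
  let ?V = "{v \<in> D. card {x \<in> D. v \<le> x} \<le> J}"
  let ?W = "{v \<in> D. J < card {x \<in> D. v \<le> x}}"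
  define w where "w = Max ?W"
  have w: "w \<in> ?W" unfolding w_def by (intro Max_in) (use assms False in auto)
  have "{x \<in> D. w \<le> x} \<subseteq> insert w ?V"
  proof
    fix x assume x: "x \<in> {x \<in> D. w \<le> x}"
    show "x \<in> insert w ?V"
    proof (cases "x \<in> ?W")
      case True
      then have "x \<le> w" unfolding w_def using assms by (intro Max_ge) auto
      then show ?thesis using x by auto
    next
      case False
      then show ?thesis using x by auto
    qed
  qed
  then have "card {x \<in> D. w \<le> x} \<le> card (insert w ?V)"
    by (intro card_mono) (use assms in auto)
  also have "\<dots> \<le> Suc (card ?V)" by (simp add: card_insert_le_m1 assms card_insert_if)
  finally show ?thesis using w by auto
qed


text \<open>
The element \<open>y = a\<close> is left out because the three elements \<open>a, x, y\<close> of a triple must be distinct.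
\<close>
definition both :: "nat set \<Rightarrow> nat \<Rightarrow> nat \<Rightarrow> nat set" where
  "both A a n = {y \<in> {1..n}. y < a \<and> y \<in> A \<and> y + a \<in> A}"

definition neither :: "nat set \<Rightarrow> nat \<Rightarrow> nat \<Rightarrow> nat set" where
  "neither A a n = {y \<in> {1..n}. y \<notin> A \<and> y + a \<notin> A}"

lemma sum_notin:
  assumes "\<not> has_triple_with_sums A" "a \<in> A" "x \<in> both A a n" "y \<in> both A a n" "x \<noteq> y"
  shows "x + y \<notin> A"
proof
  assume "x + y \<in> A"
  then have "x \<in> A" "y \<in> A" "x + a \<in> A" "y + a \<in> A" "x \<noteq> a" "y \<noteq> a"
    using assms by (auto simp: both_def)
  then show False
    using assms(1,2,5) \<open>x + y \<in> A\<close> unfolding has_triple_with_sums_def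
    by (metis add.commute)
qed

text \<open>
For the largest element \<open>M\<close> and every \<open>v\<close> among the \<open>J\<close> largest ones, at most \<open>J\<close>
representations of \<open>M + v\<close> modulo \<open>a\<close> are representations of the integer \<open>M + v\<close>, since their
summands are at least \<open>v\<close>. All others represent the integer \<open>M + v - a\<close>, the only further multiple
within range. So \<open>M + v\<close> and \<open>M + v - a\<close> are both sums of distinct elements and are absent from \<open>A\<close>.
\<close>
lemma both_le_neither:
  assumes A: "\<not> has_triple_with_sums A" and a: "a \<in> A"
  shows "4 * card (both A a n) \<le> a + card (neither A a n) + 11"
proof (cases "4 * card (both A a n) \<le> a + 11")
  case True
  then show ?thesis by simp
next
  case False
  define B where "B = both A a n"
  define k where "k = card B"
  \<comment> \<open>\<open>popular_sums\<close> provides \<open>J + 2\<close> representations, so two remain after discarding \<open>J\<close> of them, and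
    at most one of those two has equal summands.\<close>
  define J where "J = 4 * k - a - 10"
  have J: "4 * k = J + a + 10" "J > 1" using False by (simp_all add: J_def k_def B_def)
  have finB: "finite B" by (simp add: B_def both_def)
  have B: "0 < x" "x < a" "x \<le> n" "x \<in> A" "x + a \<in> A" if "x \<in> B" for x
    using that by (auto simp: B_def both_def)
  have ne: "B \<noteq> {}" using J by (auto simp: k_def)
  define M where "M = Max B"
  have M: "M \<in> B" using finB ne by (simp add: M_def)
  have leM: "x \<le> M" if "x \<in> B" for x using finB that by (simp add: M_def)
  have sums: "x + y \<notin> A" if "x \<in> B" "y \<in> B" "x \<noteq> y" for x y
    using sum_notin[OF A a] that by (simp add: B_def)
  define R where "R v = {x \<in> B. \<exists>y\<in>B. int a dvd int x + int y - (int M + int v)}" for v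
  have R: "J + 2 \<le> card (R v)" if v: "v \<in> B" for v
  proof -
    have "4 * card (int ` B) \<le> nat (int a)
        + card {x \<in> int ` B. \<exists>y\<in>int ` B. int a dvd x + y - (int M + int v)} + 8"
    proof (rule popular_sums)
      show "int ` B \<subseteq> {0<..<int a}" using B by auto
      show "int M \<in> int ` B" "int v \<in> int ` B" using M v by auto
    next
      fix x y assume "x \<in> int ` B" "y \<in> int ` B" "x \<noteq> y"
      then obtain i j where ij: "x = int i" "y = int j" "i \<in> B" "j \<in> B" "i \<noteq> j" by auto
      show "\<not> int a dvd x + y"
      proof
        assume "int a dvd x + y"
        then have "x + y = 0 \<or> x + y = int a"
          using B[of i] B[of j] ij by (intro dvd_window) auto
        then have "i + j = a" using B[of i] ij by auto
        then show False using sums ij a by auto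
      qed
    next
      fix x y z assume "x \<in> int ` B" "y \<in> int ` B" "z \<in> int ` B" "x \<noteq> y"
      then obtain i j l where ij: "x = int i" "y = int j" "z = int l"
        "i \<in> B" "j \<in> B" "l \<in> B" "i \<noteq> j" by auto
      show "\<not> int a dvd x + y - z"
      proof
        assume "int a dvd x + y - z"
        then have "x + y - z = 0 \<or> x + y - z = int a"
          using B[of i] B[of j] B[of l] ij by (intro dvd_window) auto
        then have "i + j = l \<or> i + j = l + a" using ij by linarith
        then show False using sums[of i j] ij B[of l] by auto
      qed
    qed
    moreover have "{x \<in> int ` B. \<exists>y\<in>int ` B. int a dvd x + y - (int M + int v)} = int ` R v"
      by (auto simp: R_def)
    ultimately have "4 * k \<le> a + card (R v) + 8" by (simp add: card_image k_def)
    then show ?thesis using J by simp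
  qed
  have "card (R M) \<le> k" unfolding k_def using finB by (intro card_mono) (auto simp: R_def)
  then have "J \<le> k" using R[OF M] by simp
  define V where "V = {v \<in> B. card {x \<in> B. v \<le> x} \<le> J}"
  have V: "J \<le> card V"
    unfolding V_def using card_top_elements finB \<open>J \<le> k\<close> by (simp add: k_def)
  have gap: "a < M + v \<and> M + v - a \<in> neither A a n" if v: "v \<in> V - {M}" for v
  proof -
    have vB: "v \<in> B" and vJ: "card {x \<in> B. v \<le> x} \<le> J" and vM: "M \<noteq> v"
      using v by (auto simp: V_def)
    define Y where "Y = {x \<in> B. \<exists>y\<in>B. x + y + a = M + v}"
    have "R v \<subseteq> {x \<in> B. v \<le> x} \<union> Y"
    proof
      fix x assume "x \<in> R v"
      then obtain y where xy: "x \<in> B" "y \<in> B" "int a dvd int x + int y - (int M + int v)"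
        by (auto simp: R_def)
      have "int a dvd int x + int y - (int M + int v) + int a" using xy(3) by simp
      then have "int x + int y - (int M + int v) + int a = 0
          \<or> int x + int y - (int M + int v) + int a = int a"
        using B[OF xy(1)] B[OF xy(2)] B[OF vB] B[OF M] leM[OF xy(1)] leM[OF xy(2)]
        by (intro dvd_window) auto
      then have "x + y + a = M + v \<or> x + y = M + v" by linarith
      then show "x \<in> {x \<in> B. v \<le> x} \<union> Y"
        using xy leM[OF xy(2)] by (auto simp: Y_def)
    qed
    then have "card (R v) \<le> card ({x \<in> B. v \<le> x} \<union> Y)"
      using finB by (intro card_mono) (auto simp: Y_def)
    also have "\<dots> \<le> card {x \<in> B. v \<le> x} + card Y" by (rule card_Un_le)
    finally have Y2: "2 \<le> card Y" using R[OF vB] vJ by simp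
    have "\<exists>x\<in>B. \<exists>y\<in>B. x + y + a = M + v \<and> x \<noteq> y"
    proof (rule ccontr)
      assume "\<not> ?thesis"
      then have "Y \<subseteq> {(M + v - a) div 2}" by (fastforce simp: Y_def)
      then have "card Y \<le> card {(M + v - a) div 2}" by (intro card_mono) auto
      then show False using Y2 by simp
    qed
    then obtain x y where xy: "x \<in> B" "y \<in> B" "x + y + a = M + v" "x \<noteq> y" by blast
    have t: "M + v - a = x + y" using xy(3) by simp
    have "x + y \<notin> A" "M + v \<notin> A" using sums xy vB M vM by auto
    moreover have "x + y \<le> n" using xy(3) B[OF vB] B[OF M] by linarith
    ultimately show ?thesis
      using B[OF xy(1)] xy(3) by (auto simp: neither_def t)
  qed
  have "inj_on (\<lambda>v. M + v - a) (V - {M})"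
    by (rule inj_onI) (use gap in fastforce)
  then have "card (V - {M}) = card ((\<lambda>v. M + v - a) ` (V - {M}))" by (simp add: card_image)
  also have "\<dots> \<le> card (neither A a n)"
    using gap by (intro card_mono) (auto simp: neither_def)
  finally have "J \<le> card (neither A a n) + 1"
    using V card_Diff1_le[of V M] by (auto simp: card_Diff_singleton_if split: if_splits)
  then show ?thesis using J by (simp add: k_def B_def)
qed

lemma count_pairs:
  assumes "n \<le> a"
  shows "card (A \<inter> {1..n}) + card (A \<inter> {a+1..a+n}) + card (neither A a n)
    \<le> n + card (both A a n) + 1"
proof -
  define P Q where "P = A \<inter> {1..n}" and "Q = {y \<in> {1..n}. y + a \<in> A}"
  have fin: "finite P" "finite Q" by (auto simp: P_def Q_def)
  have "A \<inter> {a+1..a+n} = (\<lambda>y. y + a) ` Q"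
  proof (intro equalityI subsetI)
    fix x assume "x \<in> A \<inter> {a+1..a+n}"
    then have "x - a \<in> Q" "x = (x - a) + a" by (auto simp: Q_def)
    then show "x \<in> (\<lambda>y. y + a) ` Q" by blast
  qed (auto simp: Q_def)
  then have Q: "card (A \<inter> {a+1..a+n}) = card Q" by (simp add: card_image)
  have "neither A a n = {1..n} - (P \<union> Q)" by (auto simp: neither_def P_def Q_def)
  moreover have "P \<union> Q \<subseteq> {1..n}" by (auto simp: P_def Q_def)
  ultimately have "card (neither A a n) + card (P \<union> Q) = n"
    using card_Diff_subset[of "P \<union> Q" "{1..n}"] card_mono[of "{1..n}" "P \<union> Q"] fin by auto
  moreover have "card P + card Q = card (P \<union> Q) + card (P \<inter> Q)" using fin by (rule card_Un_Int)
  moreover have "card (P \<inter> Q) \<le> card (insert a (both A a n))"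
    using assms by (intro card_mono) (auto simp: P_def Q_def both_def)
  moreover have "card (insert a (both A a n)) \<le> card (both A a n) + 1"
    by (simp add: card_insert_if both_def)
  ultimately show ?thesis using Q by (simp add: P_def)
qed


section \<open>Bounds for the extremal function\<close>

lemma triple_free_subset:
  "\<not> has_triple_with_sums A \<Longrightarrow> B \<subseteq> A \<Longrightarrow> \<not> has_triple_with_sums B"
  unfolding has_triple_with_sums_def by blast

text \<open>
Write \<open>G = 2a - N\<close> and \<open>G' = N - 2b\<close> for the distances of \<open>a\<close> and \<open>b\<close> from \<open>N/2\<close>, doubled. Pairs at
distance \<open>a\<close> leave out the numbers in \<open>(N - a, a)\<close>, of which \<open>A\<close> contains at most \<open>(G - G')/2\<close>,
or none if \<open>G \<le> G'\<close>; in the former case this yields \<open>4|A| \<le> 5N/2 + G/2 - 2G' + O(1)\<close> and suffices if \<open>G \<le> 4G'\<close>, that is \<open>2a + 8b \<le> 5N\<close>. Pairs at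
distance \<open>b\<close> leave out the \<open>G'\<close> numbers above \<open>2b\<close>; this yields \<open>4|A| \<le> 5N/2 + 3G'/2 - 3e + O(1)\<close>,
and \<open>e\<close> is at least the number of \<open>y < a - b\<close> outside \<open>A\<close>, by induction about
\<open>3(a - b)/8 = 3(G + G')/16\<close>, which exceeds \<open>15G'/16\<close> if \<open>G > 4G'\<close>. The additive constant of the
induction hypothesis enters \<open>8|A|\<close> with the factor \<open>3/4 < 1\<close>, so the constant \<open>128\<close> reproduces itself.
\<close>
lemma triple_free_card_le:
  "A \<subseteq> {1..N} \<Longrightarrow> \<not> has_triple_with_sums A \<Longrightarrow> 8 * card A \<le> 5 * N + 128"
proof (induction N arbitrary: A rule: less_induct)
  case (less N)
  note AN = less.prems(1) and free = less.prems(2)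
  have finA: "finite A" using AN finite_subset by blast
  define L H where "L = {x \<in> A. 2 * x < N}" and "H = {x \<in> A. N \<le> 2 * x}"
  have fin: "finite L" "finite H" using finA by (auto simp: L_def H_def)
  consider "H = {}" | "L = {}" | "H \<noteq> {}" "L \<noteq> {}" by blast
  then show ?case
  proof cases
    case 1
    then have "A \<subseteq> {1..N div 2}" using AN by (fastforce simp: H_def)
    then have "card A \<le> card {1..N div 2}" by (intro card_mono) auto
    then show ?thesis by simp
  next
    case 2
    then have "A \<subseteq> {N div 2..N}" using AN by (fastforce simp: L_def)
    then have "card A \<le> card {N div 2..N}" by (intro card_mono) auto
    then show ?thesis by simp
  next
    case 3
    define a b where "a = Min H" and "b = Max L"
    have aH: "a \<in> H" and bL: "b \<in> L" using 3 fin by (auto simp: a_def b_def)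
    have a: "a \<in> A" "N \<le> 2 * a" "a \<le> N" using aH AN by (auto simp: H_def)
    have b: "b \<in> A" "2 * b < N" "1 \<le> b" using bL AN by (auto simp: L_def)
    have split: "x \<le> b \<or> a \<le> x" if "x \<in> A" for x
    proof (cases "2 * x < N")
      case True
      then have "x \<in> L" using that by (simp add: L_def)
      then show ?thesis using fin by (simp add: b_def)
    next
      case False
      then have "x \<in> H" using that by (simp add: H_def)
      then show ?thesis using fin by (simp add: a_def)
    qed
    consider "2 * a + 8 * b \<le> 5 * N" | "5 * N < 2 * a + 8 * b" "2 * b < a"
      | "5 * N < 2 * a + 8 * b" "a \<le> 2 * b" by linarith
    then show ?thesis
    proof cases
      case 1
      define n where "n = N - a"
      have n: "n + a = N" "n \<le> a" using a by (auto simp: n_def)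
      have "A \<subseteq> (A \<inter> {1..n} \<union> A \<inter> {a+1..a+n}) \<union> insert a {n+1..b}"
        using AN split n by fastforce
      then have "card A \<le> card ((A \<inter> {1..n} \<union> A \<inter> {a+1..a+n}) \<union> insert a {n+1..b})"
        by (intro card_mono) auto
      also have "\<dots> \<le> card (A \<inter> {1..n}) + card (A \<inter> {a+1..a+n}) + card (insert a {n+1..b})"
        by (meson add_mono card_Un_le le_refl order_trans)
      also have "card (insert a {n+1..b}) \<le> (b - n) + 1" by (simp add: card_insert_if)
      finally have "card A \<le> card (A \<inter> {1..n}) + card (A \<inter> {a+1..a+n}) + ((b - n) + 1)"
        by simp
      then show ?thesis
        using count_pairs[OF n(2), of A] both_le_neither[OF free a(1), of n] n a 1
        by linarith
    next
      case 2
      \<comment> \<open>The gap is longer than \<open>b\<close>, and \<open>b\<close> exceeds \<open>3N/8\<close>, so the gap alone is large enough.\<close>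
      have "A \<subseteq> {1..b} \<union> {a..N}" using AN split by fastforce
      then have "card A \<le> card ({1..b} \<union> {a..N})" by (intro card_mono) auto
      also have "\<dots> \<le> b + (Suc N - a)" using card_Un_le[of "{1..b}" "{a..N}"] by simp
      finally show ?thesis using 2 a by linarith
    next
      case 3
      define r where "r = a - b - 1"
      have "b < a" using a b by linarith
      then have r: "r + b + 1 = a" "r < b" using 3 by (auto simp: r_def)
      have "8 * card (A \<inter> {1..r}) \<le> 5 * r + 128"
        using less.IH[of r "A \<inter> {1..r}"] triple_free_subset[OF free] r a by auto
      moreover have "r \<le> card (A \<inter> {1..r}) + card (neither A b b)"
      proof -
        have "{1..r} \<subseteq> A \<inter> {1..r} \<union> neither A b b"
          using r split by (fastforce simp: neither_def)
        then have "card {1..r} \<le> card (A \<inter> {1..r} \<union> neither A b b)"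
          by (intro card_mono) (auto simp: neither_def)
        also have "\<dots> \<le> card (A \<inter> {1..r}) + card (neither A b b)" by (rule card_Un_le)
        finally show ?thesis by simp
      qed
      moreover have "card A \<le> card (A \<inter> {1..b}) + card (A \<inter> {b+1..b+b}) + (N - 2 * b)"
      proof -
        have "A \<subseteq> (A \<inter> {1..b} \<union> A \<inter> {b+1..b+b}) \<union> {2 * b + 1..N}"
          using AN by fastforce
        then have "card A \<le> card ((A \<inter> {1..b} \<union> A \<inter> {b+1..b+b}) \<union> {2 * b + 1..N})"
          by (intro card_mono) auto
        also have "\<dots> \<le> card (A \<inter> {1..b}) + card (A \<inter> {b+1..b+b}) + card {2 * b + 1..N}"
          by (meson add_mono card_Un_le le_refl order_trans)
        finally show ?thesis by simp
      qed
      ultimately show ?thesis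
        using count_pairs[of b b A] both_le_neither[OF free b(1), of b] b r 3
        by linarith
    qed
  qed
qed

lemma f3_le:
  "8 * f3 N \<le> 5 * N + 136"
proof -
  let ?m = "(5 * N + 128) div 8 + 1"
  have "has_triple_with_sums A" if "A \<subseteq> {1..N}" "?m \<le> card A" for A
    using triple_free_card_le[OF that(1)] that(2) by (rule_tac ccontr) linarith
  then have "f3 N \<le> ?m" unfolding f3_def by (intro Least_le) auto
  then show ?thesis by linarith
qed

lemma has_triple_if_f3_le:
  assumes "A \<subseteq> {1..N}" "f3 N \<le> card A"
  shows "has_triple_with_sums A"
proof -
  have "\<forall>A. A \<subseteq> {1..N} \<and> N + 1 \<le> card A \<longrightarrow> has_triple_with_sums A"
  proof (intro allI impI)
    fix B assume B: "B \<subseteq> {1..N} \<and> N + 1 \<le> card B"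
    then have "card B \<le> card {1..N}" by (intro card_mono) auto
    then show "has_triple_with_sums B" using B by simp
  qed
  note LeastI[where P = "\<lambda>m. \<forall>A. A \<subseteq> {1..N} \<and> m \<le> card A \<longrightarrow> has_triple_with_sums A", OF this]
  then have "\<forall>A. A \<subseteq> {1..N} \<and> f3 N \<le> card A \<longrightarrow> has_triple_with_sums A"
    unfolding f3_def .
  from spec[OF this, of A] show ?thesis using assms by simp
qed

lemma f3_ge:
  assumes "1 \<le> N"
  shows "5 * N \<le> 8 * f3 N + 16"
proof -
  define S T where "S = {(N + 7) div 8..N div 4}" and "T = {N div 2 + 1..N}"
  have S: "N \<le> 8 * x" "4 * x \<le> N" if "x \<in> S" for x using that by (auto simp: S_def)
  have T: "N < 2 * x" "x \<le> N" if "x \<in> T" for x using that by (auto simp: T_def)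
  have "\<not> has_triple_with_sums (S \<union> T)"
  proof
    assume "has_triple_with_sums (S \<union> T)"
    then obtain a b c where *: "a \<in> S \<union> T" "b \<in> S \<union> T" "c \<in> S \<union> T"
      "a \<noteq> b" "a \<noteq> c" "b \<noteq> c" "a + b \<in> S \<union> T" "a + c \<in> S \<union> T" "b + c \<in> S \<union> T"
      unfolding has_triple_with_sums_def by blast
    have SS: "x + y \<notin> S \<union> T" if "x \<in> S" "y \<in> S" "x \<noteq> y" for x y
      using S[OF that(1)] S[OF that(2)] that(3) S[of "x + y"] T[of "x + y"] by force
    have TT: "x + y \<notin> S \<union> T" if "x \<in> T" "y \<in> T" for x y
      using T[OF that(1)] T[OF that(2)] S[of "x + y"] T[of "x + y"] by force
    show False using * SS TT by blast
  qed
  moreover have "S \<union> T \<subseteq> {1..N}" using assms by (auto simp: S_def T_def)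
  ultimately have "card (S \<union> T) < f3 N" using has_triple_if_f3_le not_less by blast
  moreover have "card (S \<union> T) = card S + card T"
    by (rule card_Un_disjoint) (auto simp: S_def T_def)
  moreover have "card S = Suc (N div 4) - (N + 7) div 8" "card T = N - N div 2"
    by (simp_all add: S_def T_def)
  ultimately show ?thesis by linarith
qed

theorem mainTheorem2:
  shows "\<exists>K::real. K > 0 \<and> (\<forall>N::nat. N \<ge> 1 \<longrightarrow> \<bar>real (f3 N) - 5 / 8 * real N\<bar> \<le> K)"
proof (intro exI conjI allI impI)
  fix N :: nat assume "1 \<le> N"
  then have "8 * real (f3 N) \<le> 5 * real N + 136" "5 * real N \<le> 8 * real (f3 N) + 16"
    using f3_le[of N] f3_ge[of N] by linarith+
  then show "\<bar>real (f3 N) - 5 / 8 * real N\<bar> \<le> 17" by (simp add: abs_le_iff)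
qed simp

end
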